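(* Let $X$ be a $\Delta$-normed space of functions on an index set $\Gamma$. Suppose that (a) for every $f\in X$ the set $\{\gamma\in\Gamma: f(\gamma)\neq0\}$ is at most countable; (b) for every bijection $\varphi$ of $\Gamma$, the map $f\mapsto f\circ\varphi$ is a surjective isometry of $X$. If $\Gamma$ is uncountable, then the isometry group $\operatorname{Iso}(X)$ of $X$ is algebraically nonreflexive.
   Context: Spaces are over $\mathbb K=\mathbb R$ or $\mathbb C$, and functions on $\Gamma$ are scalar-valued with pointwise linear operations. A $\Delta$-norm on a vector space $X$ is a non-negative real-valued function $\|\cdot\|$ on $X$ such that: $\|x\|>0$ for all $0\neq x\in X$; $\|\alpha x\|\le\|x\|$ for all $x\in X$ and all scalars $\alpha$ with $|\alpha|\le1$; $\lim_{\alpha\to0}\|\alpha x\|=0$ for all $x\in X$; and $\|x+y\|\le K(\|x\|+\|y\|)$ for some constant $K$ independent of $x,y\in X$. It induces a metrizable linear topology for which the sets $\{x\in X:\|x\|<1/n\}$ form a neighbourhood base at the origin. $\operatorname{Iso}(X)$ is the group of all surjective linear isometries of $X$. $B(X)$ is the algebra of all continuous linear operators on $X$. For $\mathscr S\subset B(X)$ put $\operatorname{ref}_{al}\mathscr S=\{T\in B(X): \text{for every }x\in X\text{ there is }L\in\mathscr S\text{ with }Tx=Lx\}$; $\mathscr S$ is algebraically reflexive if $\operatorname{ref}_{al}\mathscr S=\mathscr S$, and algebraically nonreflexive otherwise.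
   Formalization: The space X is additionally assumed to be nonzero; for X = {0} conditions (a) and (b) hold, but Iso(X) = B(X) consists of a single operator and is algebraically reflexive, so the claim fails there. *)

theory Defs
  imports "HOL-Analysis.Analysis" "HOL-Library.Function_Algebras"
begin

(* Scalars range over the class real_normed_field. Its norm is multiplicative, so by Mazur's
   theorem its instances are, up to isometric isomorphism, exactly the real and the complex
   numbers. A space is a subspace X of an ambient vector space with scalar multiplication s,
   together with a function N whose values matter only on X. *)

definition delta_norm_on ::
  "('k::real_normed_field \<Rightarrow> 'v::ab_group_add \<Rightarrow> 'v) \<Rightarrow> 'v set \<Rightarrow> ('v \<Rightarrow> real) \<Rightarrow> bool" where
  "delta_norm_on s X N \<longleftrightarrow>
     (\<forall>x\<in>X. 0 \<le> N x) \<and>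
     (\<forall>x\<in>X. x \<noteq> 0 \<longrightarrow> 0 < N x) \<and>
     (\<forall>x\<in>X. \<forall>a. norm a \<le> 1 \<longrightarrow> N (s a x) \<le> N x) \<and>
     (\<forall>x\<in>X. ((\<lambda>a. N (s a x)) \<longlongrightarrow> 0) (at 0)) \<and>
     (\<exists>K. \<forall>x\<in>X. \<forall>y\<in>X. N (x + y) \<le> K * (N x + N y))"

definition delta_normed_space ::
  "('k::real_normed_field \<Rightarrow> 'v::ab_group_add \<Rightarrow> 'v) \<Rightarrow> 'v set \<Rightarrow> ('v \<Rightarrow> real) \<Rightarrow> bool" where
  "delta_normed_space s X N \<longleftrightarrow>
     vector_space s \<and> module.subspace s X \<and> delta_norm_on s X N"

definition delta_open :: "'v::ab_group_add set \<Rightarrow> ('v \<Rightarrow> real) \<Rightarrow> 'v set \<Rightarrow> bool" where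
  "delta_open X N U \<longleftrightarrow> U \<subseteq> X \<and>
     (\<forall>x\<in>U. \<exists>n::nat. n \<ge> 1 \<and> (\<forall>y\<in>X. N (y - x) < 1 / real n \<longrightarrow> y \<in> U))"

definition delta_topology :: "'v::ab_group_add set \<Rightarrow> ('v \<Rightarrow> real) \<Rightarrow> 'v topology" where
  "delta_topology X N = topology (delta_open X N)"

lemma delta_open_Int:
  assumes "delta_open X N U" and "delta_open X N V"
  shows "delta_open X N (U \<inter> V)"
  unfolding delta_open_def
proof (intro conjI ballI)
  show "U \<inter> V \<subseteq> X"
    using assms unfolding delta_open_def by blast
  fix x assume x: "x \<in> U \<inter> V"
  obtain m :: nat where m: "m \<ge> 1" "\<And>y. y \<in> X \<Longrightarrow> N (y - x) < 1 / real m \<Longrightarrow> y \<in> U"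
    using assms(1) x unfolding delta_open_def by blast
  obtain n :: nat where n: "n \<ge> 1" "\<And>y. y \<in> X \<Longrightarrow> N (y - x) < 1 / real n \<Longrightarrow> y \<in> V"
    using assms(2) x unfolding delta_open_def by blast
  have le: "1 / real (max m n) \<le> 1 / real m" "1 / real (max m n) \<le> 1 / real n"
    using m(1) n(1) by (intro divide_left_mono; simp)+
  show "\<exists>k::nat. k \<ge> 1 \<and> (\<forall>y\<in>X. N (y - x) < 1 / real k \<longrightarrow> y \<in> U \<inter> V)"
  proof (intro exI[of _ "max m n"] conjI ballI impI)
    show "max m n \<ge> 1"
      using m(1) by linarith
    fix y assume y: "y \<in> X" "N (y - x) < 1 / real (max m n)"
    show "y \<in> U \<inter> V"
      using m(2)[OF y(1) less_le_trans[OF y(2) le(1)]] n(2)[OF y(1) less_le_trans[OF y(2) le(2)]]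
      by (rule IntI)
  qed
qed

lemma delta_open_Union:
  assumes "\<forall>U\<in>\<K>. delta_open X N U"
  shows "delta_open X N (\<Union>\<K>)"
  unfolding delta_open_def
proof (intro conjI ballI)
  show "\<Union>\<K> \<subseteq> X"
    using assms unfolding delta_open_def by blast
  fix x assume "x \<in> \<Union>\<K>"
  then obtain U where U: "U \<in> \<K>" "x \<in> U"
    by blast
  then obtain n :: nat where n: "n \<ge> 1" "\<forall>y\<in>X. N (y - x) < 1 / real n \<longrightarrow> y \<in> U"
    using assms unfolding delta_open_def by blast
  show "\<exists>n::nat. n \<ge> 1 \<and> (\<forall>y\<in>X. N (y - x) < 1 / real n \<longrightarrow> y \<in> \<Union>\<K>)"
    using n U by (intro exI[of _ n]) blast
qed

lemma openin_delta_topology: "openin (delta_topology X N) U \<longleftrightarrow> delta_open X N U"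
proof -
  have "istopology (delta_open X N)"
    unfolding istopology_def using delta_open_Int delta_open_Union by blast
  then show ?thesis
    unfolding delta_topology_def by (simp only: topology_inverse')
qed

definition linear_on_subspace ::
  "('k::real_normed_field \<Rightarrow> 'v::ab_group_add \<Rightarrow> 'v) \<Rightarrow> 'v set \<Rightarrow> ('v \<Rightarrow> 'v) \<Rightarrow> bool" where
  "linear_on_subspace s X T \<longleftrightarrow>
     (\<forall>x\<in>X. \<forall>y\<in>X. T (x + y) = T x + T y) \<and> (\<forall>a. \<forall>x\<in>X. T (s a x) = s a (T x))"

definition surjective_isometry :: "'v::ab_group_add set \<Rightarrow> ('v \<Rightarrow> real) \<Rightarrow> ('v \<Rightarrow> 'v) \<Rightarrow> bool" where
  "surjective_isometry X N T \<longleftrightarrow>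
     T ` X = X \<and> (\<forall>x\<in>X. \<forall>y\<in>X. N (T x - T y) = N (x - y))"

(* Operators on X are extensional functions (constantly undefined off X), so that equality of
   operators is equality on X. *)

definition continuous_ops ::
  "('k::real_normed_field \<Rightarrow> 'v::ab_group_add \<Rightarrow> 'v) \<Rightarrow> 'v set \<Rightarrow> ('v \<Rightarrow> real) \<Rightarrow> ('v \<Rightarrow> 'v) set" where
  "continuous_ops s X N = {T \<in> X \<rightarrow>\<^sub>E X. linear_on_subspace s X T \<and>
     continuous_map (delta_topology X N) (delta_topology X N) T}"

definition Iso ::
  "('k::real_normed_field \<Rightarrow> 'v::ab_group_add \<Rightarrow> 'v) \<Rightarrow> 'v set \<Rightarrow> ('v \<Rightarrow> real) \<Rightarrow> ('v \<Rightarrow> 'v) set" where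
  "Iso s X N = {T \<in> X \<rightarrow>\<^sub>E X. linear_on_subspace s X T \<and> surjective_isometry X N T}"

definition ref_al ::
  "('k::real_normed_field \<Rightarrow> 'v::ab_group_add \<Rightarrow> 'v) \<Rightarrow> 'v set \<Rightarrow> ('v \<Rightarrow> real) \<Rightarrow>
     ('v \<Rightarrow> 'v) set \<Rightarrow> ('v \<Rightarrow> 'v) set" where
  "ref_al s X N S = {T \<in> continuous_ops s X N. \<forall>x\<in>X. \<exists>L\<in>S. T x = L x}"

definition algebraically_reflexive ::
  "('k::real_normed_field \<Rightarrow> 'v::ab_group_add \<Rightarrow> 'v) \<Rightarrow> 'v set \<Rightarrow> ('v \<Rightarrow> real) \<Rightarrow>
     ('v \<Rightarrow> 'v) set \<Rightarrow> bool" where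
  "algebraically_reflexive s X N S \<longleftrightarrow> ref_al s X N S = S"

lemma topspace_delta_topology: "topspace (delta_topology X N) = X"
proof
  show "topspace (delta_topology X N) \<subseteq> X"
    using openin_topspace[of "delta_topology X N"]
    unfolding openin_delta_topology delta_open_def by (rule conjunct1)
  have "openin (delta_topology X N) X"
    unfolding openin_delta_topology delta_open_def by blast
  then show "X \<subseteq> topspace (delta_topology X N)"
    by (rule openin_subset)
qed

lemma delta_open_vimage:
  assumes "surjective_isometry X N T" and "delta_open X N U"
  shows "delta_open X N {x \<in> X. T x \<in> U}"
  unfolding delta_open_def
proof (intro conjI ballI)
  show "{x \<in> X. T x \<in> U} \<subseteq> X"
    by blast
  fix x assume "x \<in> {x \<in> X. T x \<in> U}"
  then have x: "x \<in> X" "T x \<in> U"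
    by simp_all
  obtain n :: nat where n: "n \<ge> 1" "\<forall>z\<in>X. N (z - T x) < 1 / real n \<longrightarrow> z \<in> U"
    using assms(2) x(2) unfolding delta_open_def by blast
  have "T y \<in> U" if y: "y \<in> X" "N (y - x) < 1 / real n" for y
  proof -
    have "N (T y - T x) = N (y - x)" "T y \<in> X"
      using assms(1) x(1) y(1) unfolding surjective_isometry_def by blast+
    then show ?thesis
      using n(2) y(2) by simp
  qed
  then show "\<exists>n::nat. n \<ge> 1 \<and> (\<forall>y\<in>X. N (y - x) < 1 / real n \<longrightarrow> y \<in> {x \<in> X. T x \<in> U})"
    using n(1) by (intro exI[of _ n]) simp
qed

lemma Iso_subset_continuous_ops: "Iso s X N \<subseteq> continuous_ops s X N"
proof
  fix T assume "T \<in> Iso s X N"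
  then have T: "T \<in> X \<rightarrow>\<^sub>E X" "linear_on_subspace s X T" "surjective_isometry X N T"
    unfolding Iso_def by simp_all
  have "continuous_map (delta_topology X N) (delta_topology X N) T"
    unfolding continuous_map_def topspace_delta_topology openin_delta_topology
    using T(1) delta_open_vimage[OF T(3)] by (simp add: PiE_iff Pi_iff)
  then show "T \<in> continuous_ops s X N"
    using T unfolding continuous_ops_def by simp
qed

definition fscale :: "'k::real_normed_field \<Rightarrow> ('g \<Rightarrow> 'k) \<Rightarrow> 'g \<Rightarrow> 'k" where
  "fscale a f = (\<lambda>\<gamma>. a * f \<gamma>)"

lemma vector_space_fscale: "vector_space fscale"
  by unfold_locales (auto simp: fscale_def fun_eq_iff algebra_simps)

end

theory Submission imports Defs begin

text \<open>
  Choose distinct points \<open>a 0, a 1, \<dots>\<close> of the index set and let \<open>T\<close> be the forward shift of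
  functions along them: it moves the value at \<open>a n\<close> to \<open>a (n + 1)\<close>, puts \<open>0\<close> at \<open>a 0\<close>, and leaves
  all other values alone. Every \<open>T f\<close> vanishes at \<open>a 0\<close>, whereas \<open>X\<close>, being nonzero and invariant
  under permutations, contains a function that does not. So \<open>T\<close> is not surjective, hence not in the
  isometry group (lemma \<open>nonvanishing_at\<close>).

  Nevertheless \<open>T\<close> agrees at each single \<open>f\<close> with composition with a bijection. The support of \<open>f\<close>
  and the sequence \<open>a\<close> are countable and the index set is not, so there is a sequence of distinct
  points \<open>d 0, d 1, \<dots>\<close> that avoids both. On the chain \<open>\<dots>, a 1, a 0, d 0, d 1, \<dots>\<close>, indexed by the
  integers, the one-step shift is a bijection, and \<open>f\<close> vanishes on the right half; the zero that
  \<open>T\<close> puts at \<open>a 0\<close> is therefore just the value of \<open>f\<close> at \<open>d 0\<close> (lemma \<open>seq_shift_eq_comp\<close>).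
  It follows that \<open>T\<close> maps \<open>X\<close> into \<open>X\<close> and preserves the \<open>\<Delta>\<close>-norm, so it is a continuous
  operator in the algebraic reflexive hull of the isometry group.
\<close>

section \<open>Shifts along chains of points\<close>

definition chain_shift :: "(int \<Rightarrow> 'g) \<Rightarrow> int \<Rightarrow> 'g \<Rightarrow> 'g" where
  "chain_shift e k \<gamma> = (if \<gamma> \<in> range e then e (inv e \<gamma> + k) else \<gamma>)"

lemma chain_shift_apply: "inj e \<Longrightarrow> chain_shift e k (e i) = e (i + k)"
  by (simp add: chain_shift_def)

lemma chain_shift_outside: "\<gamma> \<notin> range e \<Longrightarrow> chain_shift e k \<gamma> = \<gamma>"
  by (simp add: chain_shift_def)

lemma chain_shift_cancel:
  assumes "inj e"
  shows "chain_shift e (- k) (chain_shift e k \<gamma>) = \<gamma>"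
proof (cases "\<gamma> \<in> range e")
  case True
  then show ?thesis
    using assms by (auto simp: chain_shift_apply)
qed (simp add: chain_shift_outside)

lemma bij_chain_shift:
  assumes "inj e"
  shows "bij (chain_shift e k)"
  using chain_shift_cancel[OF assms, of k] chain_shift_cancel[OF assms, of "- k"]
  by (intro o_bij[of "chain_shift e (- k)"]) (auto simp: fun_eq_iff)

definition seq_shift :: "(nat \<Rightarrow> 'g) \<Rightarrow> ('g \<Rightarrow> 'k::zero) \<Rightarrow> 'g \<Rightarrow> 'k" where
  "seq_shift a f \<gamma> =
     (if \<gamma> \<in> range a then (case inv a \<gamma> of 0 \<Rightarrow> 0 | Suc n \<Rightarrow> f (a n)) else f \<gamma>)"

lemma seq_shift_0: "inj a \<Longrightarrow> seq_shift a f (a 0) = 0"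
  by (simp add: seq_shift_def)

lemma seq_shift_Suc: "inj a \<Longrightarrow> seq_shift a f (a (Suc n)) = f (a n)"
  by (simp add: seq_shift_def)

lemma seq_shift_outside: "\<gamma> \<notin> range a \<Longrightarrow> seq_shift a f \<gamma> = f \<gamma>"
  by (simp add: seq_shift_def)

lemma seq_shift_add:
  fixes f g :: "'g \<Rightarrow> 'k::monoid_add"
  shows "seq_shift a (f + g) = seq_shift a f + seq_shift a g"
  by (auto simp: fun_eq_iff seq_shift_def split: nat.split)

lemma seq_shift_diff:
  fixes f g :: "'g \<Rightarrow> 'k::group_add"
  shows "seq_shift a (f - g) = seq_shift a f - seq_shift a g"
  by (auto simp: fun_eq_iff seq_shift_def split: nat.split)

lemma seq_shift_fscale: "seq_shift a (fscale c f) = fscale c (seq_shift a f)"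
  by (auto simp: fun_eq_iff seq_shift_def fscale_def split: nat.split)

text \<open>
  A one-sided shift is not a permutation, but the points on which \<open>f\<close> vanishes leave room to
  complete it to a two-sided one, and the added half of the chain is invisible to \<open>f\<close>.
\<close>

lemma seq_shift_eq_comp:
  fixes f :: "'g \<Rightarrow> 'k::zero"
  assumes a: "inj (a :: nat \<Rightarrow> 'g)"
    and room: "infinite {\<gamma>. f \<gamma> = 0 \<and> \<gamma> \<notin> range a}"
  obtains \<phi> where "bij \<phi>" "seq_shift a f = f \<circ> \<phi>"
proof -
  obtain d :: "nat \<Rightarrow> 'g" where d: "inj d" "range d \<subseteq> {\<gamma>. f \<gamma> = 0 \<and> \<gamma> \<notin> range a}"
    using infinite_countable_subset[OF room] by blast
  have f_d: "f (d n) = 0" and d_a: "d n \<noteq> a m" for n m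
    using d(2) by auto
  define e where "e k = (if k < 0 then a (nat (- k - 1)) else d (nat k))" for k :: int
  have "inj e"
  proof (rule injI)
    fix i j assume "e i = e j"
    then show "i = j"
      using d_a d_a[symmetric]
      by (auto simp: e_def inj_eq[OF a] inj_eq[OF d(1)] split: if_splits)
  qed
  have e_a: "e (- 1 - int n) = a n" and e_d: "e (int n) = d n" for n
    by (simp_all add: e_def)
  have a_0: "chain_shift e 1 (a 0) = d 0"
    using chain_shift_apply[OF \<open>inj e\<close>, of 1 "- 1"] e_a[of 0] e_d[of 0] by simp
  have a_Suc: "chain_shift e 1 (a (Suc n)) = a n" for n
    using chain_shift_apply[OF \<open>inj e\<close>, of 1 "- 1 - int (Suc n)"] e_a[of "Suc n"] e_a[of n] by simp
  have d_n: "chain_shift e 1 (d n) = d (Suc n)" for n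
    using chain_shift_apply[OF \<open>inj e\<close>, of 1 "int n"] e_d[of n] e_d[of "Suc n"]
    by (simp add: add.commute)
  have "seq_shift a f \<gamma> = f (chain_shift e 1 \<gamma>)" for \<gamma>
  proof -
    consider "\<gamma> = a 0" | n where "\<gamma> = a (Suc n)" | n where "\<gamma> = d n"
      | "\<gamma> \<notin> range a" "\<gamma> \<notin> range d"
      by (metis nat.exhaust rangeE)
    then show ?thesis
    proof cases
      case 1
      then show ?thesis by (simp add: seq_shift_0 a a_0 f_d)
    next
      case 2
      then show ?thesis by (simp add: seq_shift_Suc a a_Suc)
    next
      case 3
      moreover have "d n \<notin> range a"
        using d_a by blast
      ultimately show ?thesis by (simp add: seq_shift_outside d_n f_d)
    next
      case 4
      then have "\<gamma> \<notin> range e"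
        by (auto simp: e_def)
      then show ?thesis
        using 4 by (simp add: seq_shift_outside chain_shift_outside)
    qed
  qed
  then have "seq_shift a f = f \<circ> chain_shift e 1"
    by (simp add: fun_eq_iff)
  then show thesis
    using that bij_chain_shift[OF \<open>inj e\<close>] by blast
qed

section \<open>Operators on permutation-invariant spaces\<close>

text \<open>
  The shift is isometric but not onto, so its continuity has to be derived from the preservation of
  distances alone.
\<close>

lemma delta_open_vimage_isometric:
  assumes maps: "T ` X \<subseteq> X"
    and isometric: "\<And>x y. x \<in> X \<Longrightarrow> y \<in> X \<Longrightarrow> N (T x - T y) = N (x - y)"
    and U: "delta_open X N U"
  shows "delta_open X N {x \<in> X. T x \<in> U}"
  unfolding delta_open_def
proof (intro conjI ballI)
  fix x assume x: "x \<in> {x \<in> X. T x \<in> U}"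
  then obtain n :: nat where n: "n \<ge> 1" "\<forall>z\<in>X. N (z - T x) < 1 / real n \<longrightarrow> z \<in> U"
    using U unfolding delta_open_def by blast
  have "T y \<in> U" if y: "y \<in> X" "N (y - x) < 1 / real n" for y
    using n(2) maps isometric[of y x] x y by auto
  then show "\<exists>n::nat. n \<ge> 1 \<and> (\<forall>y\<in>X. N (y - x) < 1 / real n \<longrightarrow> y \<in> {x \<in> X. T x \<in> U})"
    using n(1) by blast
qed blast

lemma isometric_in_continuous_ops:
  assumes "T \<in> X \<rightarrow>\<^sub>E X" "linear_on_subspace s X T"
    and "\<And>x y. x \<in> X \<Longrightarrow> y \<in> X \<Longrightarrow> N (T x - T y) = N (x - y)"
  shows "T \<in> continuous_ops s X N"
proof -
  have "T ` X \<subseteq> X"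
    using assms(1) by (auto simp: PiE_iff)
  then have "continuous_map (delta_topology X N) (delta_topology X N) T"
    unfolding continuous_map_def topspace_delta_topology openin_delta_topology
    using delta_open_vimage_isometric[OF _ assms(3)] by blast
  then show ?thesis
    using assms(1,2) unfolding continuous_ops_def by simp
qed

lemma linear_on_subspace_restrict:
  assumes "vector_space s" "module.subspace s X"
  shows "linear_on_subspace s X (restrict T X) \<longleftrightarrow> linear_on_subspace s X T"
proof -
  interpret vector_space s by fact
  show ?thesis
    using assms(2) by (simp add: linear_on_subspace_def subspace_add subspace_scale)
qed

lemma comp_in_Iso:
  fixes X :: "('g \<Rightarrow> 'k::real_normed_field) set"
  assumes X: "module.subspace fscale X"
    and \<phi>: "surjective_isometry X N (\<lambda>f. f \<circ> \<phi>)"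
  shows "restrict (\<lambda>f. f \<circ> \<phi>) X \<in> Iso fscale X N"
proof -
  have "(\<lambda>f. f \<circ> \<phi>) ` X = X"
    using \<phi> unfolding surjective_isometry_def by blast
  then have "restrict (\<lambda>f. f \<circ> \<phi>) X \<in> X \<rightarrow>\<^sub>E X"
    by auto
  moreover have "linear_on_subspace fscale X (restrict (\<lambda>f. f \<circ> \<phi>) X)"
    unfolding linear_on_subspace_restrict[OF vector_space_fscale X]
    by (auto simp: linear_on_subspace_def fscale_def fun_eq_iff)
  moreover have "surjective_isometry X N (restrict (\<lambda>f. f \<circ> \<phi>) X)"
    using \<phi> by (simp add: surjective_isometry_def)
  ultimately show ?thesis
    unfolding Iso_def by blast
qed

text \<open>A transposition carries a point of the support of any nonzero function to the given point.\<close>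

lemma nonvanishing_at:
  fixes X :: "('g \<Rightarrow> 'k::zero) set"
  assumes "f \<in> X" "f \<gamma> \<noteq> 0"
    and inv: "\<And>\<phi> :: 'g \<Rightarrow> 'g. bij \<phi> \<Longrightarrow> (\<lambda>f. f \<circ> \<phi>) ` X = X"
  obtains g where "g \<in> X" "g \<alpha> \<noteq> 0"
proof -
  have "f \<circ> Transposition.transpose \<alpha> \<gamma> \<in> X"
    using inv[of "Transposition.transpose \<alpha> \<gamma>"] assms(1) by auto
  then show thesis
    using assms(2) that[of "f \<circ> Transposition.transpose \<alpha> \<gamma>"] by simp
qed

section \<open>Nonreflexivity of the isometry group\<close>

theorem mainTheorem2:
  fixes X :: "('g \<Rightarrow> 'k::real_normed_field) set" and N :: "('g \<Rightarrow> 'k) \<Rightarrow> real"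
  assumes space: "delta_normed_space fscale X N"
    and nontrivial: "X \<noteq> {0}"
    and supp: "\<And>f. f \<in> X \<Longrightarrow> countable {\<gamma>. f \<gamma> \<noteq> 0}"
    and bij_invariant: "\<And>\<phi> :: 'g \<Rightarrow> 'g. bij \<phi> \<Longrightarrow> surjective_isometry X N (\<lambda>f. f \<circ> \<phi>)"
    and uncountable: "uncountable (UNIV :: 'g set)"
  shows "\<not> algebraically_reflexive fscale X N (Iso fscale X N)"
proof -
  interpret vector_space "fscale :: 'k \<Rightarrow> ('g \<Rightarrow> 'k) \<Rightarrow> 'g \<Rightarrow> 'k"
    by (rule vector_space_fscale)
  have X: "subspace X"
    using space unfolding delta_normed_space_def by blast
  have image: "(\<lambda>f. f \<circ> \<phi>) ` X = X" if "bij \<phi>" for \<phi> :: "'g \<Rightarrow> 'g"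
    using bij_invariant[OF that] unfolding surjective_isometry_def by blast
  have N_comp: "N (f \<circ> \<phi>) = N f" if "bij \<phi>" "f \<in> X" for f and \<phi> :: "'g \<Rightarrow> 'g"
  proof -
    have "N ((f \<circ> \<phi>) - (0 \<circ> \<phi>)) = N (f - 0)"
      using bij_invariant[OF that(1)] that(2) subspace_0[OF X]
      unfolding surjective_isometry_def by blast
    moreover have "(f \<circ> \<phi>) - (0 \<circ> \<phi>) = f \<circ> \<phi>"
      by (simp add: fun_eq_iff)
    ultimately show ?thesis
      by simp
  qed
  obtain a :: "nat \<Rightarrow> 'g" where a: "inj a"
    using infinite_countable_subset[OF uncountable_infinite[OF uncountable]] by blast
  have as_comp: "\<exists>\<phi>. bij \<phi> \<and> seq_shift a f = f \<circ> \<phi>" if "f \<in> X" for f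
  proof -
    have "uncountable (UNIV - ({\<gamma>. f \<gamma> \<noteq> 0} \<union> range a))"
      using uncountable supp[OF that] by (intro uncountable_minus_countable) auto
    moreover have "UNIV - ({\<gamma>. f \<gamma> \<noteq> 0} \<union> range a) = {\<gamma>. f \<gamma> = 0 \<and> \<gamma> \<notin> range a}"
      by blast
    ultimately have "infinite {\<gamma>. f \<gamma> = 0 \<and> \<gamma> \<notin> range a}"
      by (simp add: uncountable_infinite)
    then show ?thesis
      using seq_shift_eq_comp[OF a] by metis
  qed
  have mem: "seq_shift a f \<in> X" and N_shift: "N (seq_shift a f) = N f" if "f \<in> X" for f
    using as_comp[OF that] image N_comp[OF _ that] that by auto
  define T where "T = restrict (seq_shift a) X"
  have "T \<in> X \<rightarrow>\<^sub>E X"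
    using mem by (auto simp: T_def)
  moreover have "linear_on_subspace fscale X T"
    unfolding T_def linear_on_subspace_restrict[OF vector_space_fscale X]
    by (simp add: linear_on_subspace_def seq_shift_add seq_shift_fscale)
  moreover have "N (T f - T g) = N (f - g)" if "f \<in> X" "g \<in> X" for f g
    using that N_shift[OF subspace_diff[OF X that]] by (simp add: T_def seq_shift_diff)
  ultimately have "T \<in> continuous_ops fscale X N"
    by (intro isometric_in_continuous_ops)
  moreover have "\<exists>L\<in>Iso fscale X N. T f = L f" if f: "f \<in> X" for f
  proof -
    obtain \<phi> where \<phi>: "bij \<phi>" "seq_shift a f = f \<circ> \<phi>"
      using as_comp[OF f] by blast
    then show ?thesis
      using comp_in_Iso[OF X bij_invariant[OF \<phi>(1)]] f
      by (intro bexI[of _ "restrict (\<lambda>f. f \<circ> \<phi>) X"]) (simp_all add: T_def)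
  qed
  ultimately have "T \<in> ref_al fscale X N (Iso fscale X N)"
    unfolding ref_al_def by blast
  moreover have "T \<notin> Iso fscale X N"
  proof
    assume "T \<in> Iso fscale X N"
    then have onto: "T ` X = X"
      unfolding Iso_def surjective_isometry_def by blast
    obtain f where "f \<in> X" "f \<noteq> 0"
      using nontrivial subspace_0[OF X] by blast
    then obtain \<gamma> where "f \<gamma> \<noteq> 0"
      by (auto simp: fun_eq_iff)
    then obtain g where g: "g \<in> X" "g (a 0) \<noteq> 0"
      using nonvanishing_at[OF \<open>f \<in> X\<close> _ image] by metis
    then obtain h where "h \<in> X" "g = T h"
      using onto by blast
    then show False
      using g(2) by (simp add: T_def seq_shift_0[OF a])
  qed
  ultimately show ?thesis
    unfolding algebraically_reflexive_def by blast
qed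

end
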